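(* If $f(x)=\sum_{k=0}^n a_k x^k\in\mathbb{R}[x]$ has all of its zeros in the interval $(-1,1)$, then the polynomial $T[f](x)=\sum_{k=0}^n a_k P_k(x)$ has all of its zeros in $(-1,1)$, where $P_k$ is the $k$-th Legendre polynomial.
   Context: "All of its zeros" means all complex zeros; the assertion is that each of them is real and lies in the open interval $(-1,1)$. The Legendre polynomials $P_k(x)$ are defined by the generating function $(1-2xt+t^2)^{-1/2}=\sum_{k=0}^\infty P_k(x)t^k$. *)

theory Defs
  imports "HOL-Analysis.Analysis"
begin

(* The binomial series (1 + u) to the power -1/2, as a power series in u over the ring of
   real polynomials in x. The library's fps_binomial needs a coefficient field, so its
   coefficients are taken over the reals and embedded as constant polynomials. *)
definition inv_sqrt_series :: "real poly fps" where
  "inv_sqrt_series = Abs_fps (\<lambda>j. [:fps_nth (fps_binomial (-1/2)) j:])"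

(* u = - 2 x t + t^2, with t the power series variable *)
definition legendre_arg :: "real poly fps" where
  "legendre_arg = fps_const [:0, -2:] * fps_X + fps_X ^ 2"

definition legendre_genfun :: "real poly fps" where
  "legendre_genfun = inv_sqrt_series oo legendre_arg"

definition legendre :: "nat \<Rightarrow> real poly" where
  "legendre k = fps_nth legendre_genfun k"

definition legendre_transform :: "real poly \<Rightarrow> real poly" where
  "legendre_transform f = (\<Sum>k\<le>degree f. smult (coeff f k) (legendre k))"

lemma inv_sqrt_series_square: "inv_sqrt_series ^ 2 * (1 + fps_X) = 1"
proof -
  define b :: "real fps" where "b = fps_binomial (-1/2)"
  have "b * b = fps_binomial (-1)"
    using fps_binomial_add_mult[of "-1/2 :: real" "-1/2"] by (simp add: b_def)
  then have "b ^ 2 * (1 + fps_X) = 1"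
    by (simp add: power2_eq_square fps_binomial_minus_one inverse_mult_eq_1)
  then have *: "fps_nth (b * b * (1 + fps_X)) n = fps_nth 1 n" for n
    by (simp add: power2_eq_square)
  have sq: "fps_nth (inv_sqrt_series * inv_sqrt_series) n = [:fps_nth (b * b) n:]" for n
    unfolding inv_sqrt_series_def fps_mult_nth b_def[symmetric]
    by (simp add: poly_eq_iff coeff_sum coeff_pCons mult.commute split: nat.split)
  show ?thesis
  proof (rule fps_ext)
    fix n
    show "fps_nth (inv_sqrt_series ^ 2 * (1 + fps_X)) n = fps_nth 1 n"
      using *[of n]
      by (cases n) (simp_all add: power2_eq_square distrib_left sq one_pCons del: fps_mult_nth_0)
  qed
qed

(* These two facts determine legendre_genfun as the series with constant term 1 whose square
   is inverse to 1 - 2 x t + t^2. *)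
lemma legendre_genfun_square:
  "legendre_genfun ^ 2 * (1 - fps_const [:0, 2:] * fps_X + fps_X ^ 2) = 1"
proof -
  have 0: "fps_nth legendre_arg 0 = 0"
    by (simp add: legendre_arg_def)
  have "(inv_sqrt_series ^ 2 * (1 + fps_X)) oo legendre_arg = 1"
    by (simp add: inv_sqrt_series_square)
  then have "legendre_genfun ^ 2 * (1 + legendre_arg) = 1"
    by (simp add: power2_eq_square fps_compose_mult_distrib[OF 0]
        fps_compose_add_distrib fps_X_fps_compose_startby0[OF 0] legendre_genfun_def)
  moreover
  have c: "fps_const [:0, -2:] = - fps_const [:0, 2 :: real:]"
    by (simp add: fps_eq_iff)
  have "1 + legendre_arg = 1 - fps_const [:0, 2:] * fps_X + fps_X ^ 2"
    unfolding legendre_arg_def c by (simp only: minus_mult_left[symmetric] diff_conv_add_uminus add.assoc)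
  ultimately show ?thesis
    by (simp only:)
qed

lemma legendre_genfun_nth_0: "fps_nth legendre_genfun 0 = 1"
  by (simp add: legendre_genfun_def inv_sqrt_series_def one_pCons)

end

theory Submission
  imports Defs "HOL-Computational_Algebra.Fundamental_Theorem_Algebra"
begin

text \<open>
  Write \<open>w x t = 1 - 2 x t + t\<^sup>2\<close> and \<open>Q\<close> for the transform of \<open>f\<close>. The Poisson kernel
  recovers \<open>f\<close> from \<open>Q\<close>: for \<open>\<bar>t\<bar> < 1\<close>,
  \<open>(1 - t\<^sup>2)/2 * (\<integral> Q x * w x t powr (-3/2) dx over [-1,1]) = f t\<close>,
  because it sends \<open>P\<^sub>k\<close> to \<open>t ^ k\<close> (\<open>kernel_integral_legendre\<close>). So zeros of \<open>f\<close> are zeros of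
  an integral transform of \<open>Q\<close>, and that transform is variation diminishing: in \<open>(-1,1)\<close> it has at
  most as many distinct zeros as \<open>Q\<close> has sign changes (\<open>kernel_zeros_le_sign_changes\<close>).

  The reason for the latter is Rolle's theorem. If \<open>Q\<close> changes sign at \<open>r\<close>, multiply the transform
  with exponent \<open>p\<close> by \<open>w r t powr p\<close> and differentiate in \<open>t\<close>. Up to a positive factor the result
  is the transform of \<open>(x - r) Q x\<close> with exponent \<open>p + 1\<close>. At most one zero is lost, and so is one
  sign change; a \<open>Q\<close> without sign changes has a transform without zeros.

  If \<open>f\<close> has \<open>n = degree f\<close> distinct zeros in \<open>(-1,1)\<close>, then \<open>Q\<close>, of degree at most \<open>n\<close>, has \<open>n\<close>
  sign changes there, and these are all its zeros (\<open>legendre_transform_distinct\<close>). Multiple zeros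
  of \<open>f\<close> are pulled apart and the limit is taken, which confines the zeros of \<open>Q\<close> to the closed
  interval (\<open>legendre_transform_root_closed\<close>). The end points are no zeros since
  \<open>P\<^sub>k 1 = 1\<close> and \<open>P\<^sub>k (-1) = (-1) ^ k\<close> give \<open>Q 1 = f 1\<close> and \<open>Q (-1) = f (-1)\<close>.
\<close>

section \<open>Legendre polynomials from the generating function\<close>

definition fps_coeffwise :: "('a \<Rightarrow> 'b) \<Rightarrow> 'a fps \<Rightarrow> 'b fps" where
  "fps_coeffwise h F = Abs_fps (\<lambda>k. h (fps_nth F k))"

lemma fps_coeffwise_nth [simp]: "fps_nth (fps_coeffwise h F) k = h (fps_nth F k)"
  by (simp add: fps_coeffwise_def)

definition legendre_quad :: "real poly fps" where
  "legendre_quad = 1 - fps_const [:0, 2:] * fps_X + fps_X ^ 2"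

text \<open>The formal square root of \<open>1 - 2 x s + s\<^sup>2\<close> with constant term 1, \<open>s\<close> being the series
  variable. Its derivative in \<open>x\<close> and its values at \<open>x = 1\<close> and \<open>x = -1\<close> are simple, and it is what
  an antiderivative of generating function times Poisson kernel is made of.\<close>

definition legendre_root :: "real poly fps" where
  "legendre_root = legendre_quad * legendre_genfun"

lemma legendre_root_mult_genfun: "legendre_root * legendre_genfun = 1"
  using legendre_genfun_square
  by (simp add: legendre_root_def legendre_quad_def power2_eq_square mult_ac)

lemma legendre_root_square: "legendre_root * legendre_root = legendre_quad"
proof -
  have "legendre_root * legendre_root = legendre_quad * (legendre_root * legendre_genfun)"
    by (subst (2) legendre_root_def) (simp only: mult_ac)
  then show ?thesis
    by (simp add: legendre_root_mult_genfun)
qed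

lemma pderiv_sum:
  fixes g :: "'a \<Rightarrow> real poly"
  shows "pderiv (\<Sum>i\<in>A. g i) = (\<Sum>i\<in>A. pderiv (g i))"
  by (induction A rule: infinite_finite_induct) (simp_all add: pderiv_add)

lemma fps_coeffwise_pderiv_mult:
  fixes F K :: "real poly fps"
  shows "fps_coeffwise pderiv (F * K) = fps_coeffwise pderiv F * K + F * fps_coeffwise pderiv K"
proof (rule fps_ext)
  fix n
  show "fps_nth (fps_coeffwise pderiv (F * K)) n
      = fps_nth (fps_coeffwise pderiv F * K + F * fps_coeffwise pderiv K) n"
    unfolding fps_coeffwise_nth fps_add_nth fps_mult_nth pderiv_sum pderiv_mult
      sum.distrib[symmetric]
    by (rule sum.cong) (simp_all add: mult.commute add.commute)
qed

lemma fps_coeffwise_poly_mult: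
  fixes F K :: "real poly fps"
  shows "fps_coeffwise (\<lambda>p. poly p x) (F * K)
           = fps_coeffwise (\<lambda>p. poly p x) F * fps_coeffwise (\<lambda>p. poly p x) K"
  by (rule fps_ext) (simp add: fps_mult_nth poly_sum)

text \<open>The formal version of \<open>d/dx sqrt (1 - 2 x s + s\<^sup>2) = - s / sqrt (1 - 2 x s + s\<^sup>2)\<close>:
  differentiate the square of the root and cancel.\<close>

lemma legendre_root_pderiv:
  "fps_coeffwise pderiv legendre_root = - (fps_X * legendre_genfun)"
proof -
  let ?D = "fps_coeffwise (pderiv :: real poly \<Rightarrow> real poly)"
  have "?D legendre_quad = - (2 * fps_X)"
    by (rule fps_ext)
       (auto simp: legendre_quad_def pderiv_pCons pderiv_diff pderiv_add pderiv_minus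
         fps_X_power_nth fps_X_nth numeral_fps_const one_pCons pderiv_mult numeral_poly)
  moreover have "?D legendre_quad = 2 * (?D legendre_root * legendre_root)"
    unfolding legendre_root_square[symmetric] fps_coeffwise_pderiv_mult by (simp add: mult_ac)
  ultimately have "2 * (?D legendre_root * legendre_root) = 2 * (- fps_X)"
    by simp
  moreover have "(2 :: real poly fps) \<noteq> 0"
    by simp
  ultimately have "?D legendre_root * legendre_root = - fps_X"
    using mult_left_cancel by blast
  then have "?D legendre_root * (legendre_root * legendre_genfun) = - fps_X * legendre_genfun"
    by (simp only: mult.assoc[symmetric])
  then show ?thesis
    by (simp add: legendre_root_mult_genfun)
qed

text \<open>At \<open>x = 1\<close> and \<open>x = -1\<close> the quadratic is a perfect square, and the constant term selects the
  sign of its root.\<close>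

lemma legendre_root_at_endpoint:
  assumes "e ^ 2 = (1 :: real)"
  shows "fps_coeffwise (\<lambda>p. poly p e) legendre_root = 1 - fps_const e * fps_X"
proof -
  let ?E = "fps_coeffwise (\<lambda>p. poly p e)"
  have ee: "e * e = 1" using assms by (simp add: power2_eq_square)
  have "?E legendre_quad = 1 - fps_const (2 * e) * fps_X + fps_X ^ 2"
    by (rule fps_ext)
       (auto simp: legendre_quad_def fps_X_power_nth fps_X_nth one_pCons)
  also have "\<dots> = (1 - fps_const e * fps_X) * (1 - fps_const e * fps_X)"
  proof -
    have "fps_const e * fps_X * (fps_const e * fps_X) = fps_const (e * e) * (fps_X * fps_X)"
      by (simp only: mult_ac fps_const_mult[symmetric])
    moreover have "fps_const (2 * e) = fps_const e + fps_const e" by simp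
    ultimately show ?thesis
      unfolding ee by (simp add: algebra_simps power2_eq_square del: fps_const_add)
  qed
  finally have "?E legendre_root * ?E legendre_root = \<dots>"
    by (simp add: fps_coeffwise_poly_mult[symmetric] legendre_root_square)
  then have "?E legendre_root = 1 - fps_const e * fps_X \<or>
      ?E legendre_root = - (1 - fps_const e * fps_X)"
    by (simp add: square_eq_iff)
  moreover have "fps_nth (?E legendre_root) 0 = 1"
    by (simp add: legendre_root_def legendre_quad_def legendre_genfun_nth_0)
  then have "?E legendre_root \<noteq> - (1 - fps_const e * fps_X)"
    by (auto simp del: fps_coeffwise_nth)
  ultimately show ?thesis
    by blast
qed

lemma fps_geometric_unique:
  fixes F :: "real fps"
  assumes "(1 - fps_const a * fps_X) * F = fps_const c"
  shows "fps_nth F k = c * a ^ k"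
proof -
  have F: "F = fps_const c + fps_const a * (fps_X * F)"
    using assms by (simp add: algebra_simps)
  show ?thesis
  proof (induction k)
    case 0
    show ?case by (subst F) simp
  next
    case (Suc k)
    have "fps_nth F (Suc k) = fps_nth (fps_const c + fps_const a * (fps_X * F)) (Suc k)"
      using F by simp
    with Suc show ?case by simp
  qed
qed

lemma poly_legendre_at_endpoint:
  assumes "e ^ 2 = (1 :: real)"
  shows "poly (legendre k) e = e ^ k"
proof -
  have "(1 - fps_const e * fps_X) * fps_coeffwise (\<lambda>p. poly p e) legendre_genfun = fps_const 1"
    unfolding legendre_root_at_endpoint[OF assms, symmetric]
      fps_coeffwise_poly_mult[symmetric] legendre_root_mult_genfun
    by (rule fps_ext) simp
  from fps_geometric_unique[OF this, of k] show ?thesis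
    by (simp add: legendre_def)
qed

lemma degree_fps_mult_le:
  fixes F K :: "real poly fps"
  assumes "\<And>k. degree (fps_nth F k) \<le> k" "\<And>k. degree (fps_nth K k) \<le> k"
  shows "degree (fps_nth (F * K) k) \<le> k"
  unfolding fps_mult_nth
proof (rule degree_sum_le)
  fix i assume i: "i \<in> {0..k}"
  have "degree (fps_nth F i * fps_nth K (k - i)) \<le> i + (k - i)"
    by (rule order.trans[OF degree_mult_le add_mono[OF assms]])
  then show "degree (fps_nth F i * fps_nth K (k - i)) \<le> k"
    using i by simp
qed simp

text \<open>The coefficients of \<open>- 2 x t + t\<^sup>2\<close> satisfy the degree bound, which products and sums
  preserve.\<close>

lemma degree_legendre_le: "degree (legendre k) \<le> k"
proof -
  have arg: "degree (fps_nth legendre_arg k) \<le> k" for k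
    by (auto simp: legendre_arg_def fps_X_power_nth fps_X_nth)
  have pow: "degree (fps_nth (legendre_arg ^ j) k) \<le> k" for j k
  proof (induction j arbitrary: k)
    case (Suc j)
    show ?case
      unfolding power_Suc by (rule degree_fps_mult_le[OF arg Suc])
  qed simp
  show ?thesis
    unfolding legendre_def legendre_genfun_def fps_compose_nth
  proof (rule degree_sum_le)
    fix i
    have "degree (fps_nth inv_sqrt_series i * fps_nth (legendre_arg ^ i) k) \<le> 0 + k"
      by (rule order.trans[OF degree_mult_le add_mono[OF _ pow]])
         (simp add: inv_sqrt_series_def)
    then show "degree (fps_nth inv_sqrt_series i * fps_nth (legendre_arg ^ i) k) \<le> k"
      by simp
  qed simp
qed

section \<open>The Poisson kernel maps Legendre polynomials to powers\<close>

definition poisson_quad :: "real \<Rightarrow> real \<Rightarrow> real" where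
  "poisson_quad x t = 1 - 2 * x * t + t\<^sup>2"

lemma poisson_quad_pos:
  assumes "x \<in> {-1..1}" "t \<in> {-1<..<1}"
  shows "poisson_quad x t > 0"
proof -
  have eq: "poisson_quad x t = (t - x)\<^sup>2 + (1 - x) * (1 + x)"
    by (simp add: poisson_quad_def power2_eq_square algebra_simps)
  have "0 \<le> (1 - x) * (1 + x)" using assms by simp
  moreover have "0 < (t - x)\<^sup>2" if "x = 1 \<or> x = -1" using that assms by auto
  moreover have "0 < (1 - x) * (1 + x)" if "x \<noteq> 1" "x \<noteq> -1" using that assms by auto
  ultimately show ?thesis
    unfolding eq by (smt (verit) zero_le_power2)
qed

text \<open>The exponent \<open>p\<close> is a parameter because Rolle's theorem raises it by one at each use; for
  \<open>p = 3/2\<close> this is the Poisson integral without its factor \<open>(1 - t\<^sup>2)/2\<close>.\<close>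

definition kernel_integral :: "real \<Rightarrow> real poly \<Rightarrow> real \<Rightarrow> real" where
  "kernel_integral p Q t = integral {-1..1} (\<lambda>x. poly Q x * poisson_quad x t powr (-p))"

lemma kernel_continuous:
  assumes "t \<in> {-1<..<1}"
  shows "continuous_on {-1..1} (\<lambda>x. poly Q x * poisson_quad x t powr (-p))"
proof -
  have "continuous_on {-1..1} (\<lambda>x. poisson_quad x t)"
    unfolding poisson_quad_def by (intro continuous_intros)
  then show ?thesis
    using poisson_quad_pos[OF _ assms] by (intro continuous_intros) force+
qed

lemma kernel_integrable:
  assumes "t \<in> {-1<..<1}"
  shows "(\<lambda>x. poly Q x * poisson_quad x t powr (-p)) integrable_on {-1..1}"
  by (rule integrable_continuous_real[OF kernel_continuous[OF assms]])

lemma kernel_integral_smult: "kernel_integral p (smult c Q) t = c * kernel_integral p Q t"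
  by (simp add: kernel_integral_def mult.assoc)

lemma kernel_integral_0 [simp]: "kernel_integral p 0 t = 0"
  by (simp add: kernel_integral_def)

lemma kernel_integral_add:
  assumes "t \<in> {-1<..<1}"
  shows "kernel_integral p (P + Q) t = kernel_integral p P t + kernel_integral p Q t"
  using assms unfolding kernel_integral_def
  by (simp add: distrib_right integral_add kernel_integrable)

lemma kernel_integral_diff:
  assumes "t \<in> {-1<..<1}"
  shows "kernel_integral p (P - Q) t = kernel_integral p P t - kernel_integral p Q t"
  using assms unfolding kernel_integral_def
  by (simp add: left_diff_distrib integral_diff kernel_integrable)

lemma kernel_integral_sum:
  assumes "t \<in> {-1<..<1}" "finite A"
  shows "kernel_integral p (\<Sum>i\<in>A. Q i) t = (\<Sum>i\<in>A. kernel_integral p (Q i) t)"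
  using assms(2) by induction (simp_all add: kernel_integral_add[OF assms(1)])

text \<open>The integrand is the derivative of \<open>poly Q x / sqrt (poisson_quad x t)\<close>, and at the end points
  the square root is \<open>1 - t\<close> or \<open>1 + t\<close>.\<close>

lemma kernel_integral_exact:
  assumes t: "t \<in> {-1<..<1}"
  shows "kernel_integral (3/2) (smult t Q + [:1 + t\<^sup>2, -2 * t:] * pderiv Q) t
           = poly Q 1 / (1 - t) - poly Q (-1) / (1 + t)"
proof -
  have "((\<lambda>x. poly (smult t Q + [:1 + t\<^sup>2, -2 * t:] * pderiv Q) x * poisson_quad x t powr (-(3/2)))
      has_integral poly Q 1 * poisson_quad 1 t powr (-(1/2))
        - poly Q (-1) * poisson_quad (-1) t powr (-(1/2))) {-1..1}"
  proof (rule fundamental_theorem_of_calculus)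
    fix x :: real assume x: "x \<in> {-1..1}"
    have pos: "poisson_quad x t > 0" by (rule poisson_quad_pos[OF x t])
    have quad: "((\<lambda>x. poisson_quad x t) has_real_derivative - 2 * t) (at x within {-1..1})"
      unfolding poisson_quad_def by (auto intro!: derivative_eq_intros)
    have half: "((\<lambda>x. poisson_quad x t powr (-(1/2))) has_real_derivative
        -(1/2) * poisson_quad x t powr (-(1/2) - 1) * (-2 * t)) (at x within {-1..1})"
      using has_real_derivative_powr[OF pos] quad by (rule DERIV_chain2)
    have poly: "(poly Q has_real_derivative poly (pderiv Q) x) (at x within {-1..1})"
      by (rule poly_DERIV[THEN DERIV_subset]) simp
    have "poisson_quad x t powr (-(1/2)) = poisson_quad x t * poisson_quad x t powr (-(3/2))"
      using powr_add[of "poisson_quad x t" 1 "-(3/2)"] pos by simp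
    moreover have "poly [:1 + t\<^sup>2, -2 * t:] x = poisson_quad x t"
      by (simp add: poisson_quad_def)
    ultimately have "((\<lambda>x. poly Q x * poisson_quad x t powr (-(1/2))) has_real_derivative
        poly (smult t Q + [:1 + t\<^sup>2, -2 * t:] * pderiv Q) x * poisson_quad x t powr (-(3/2)))
        (at x within {-1..1})"
      by (intro DERIV_cong[OF DERIV_mult[OF poly half]])
        (simp only: poly_add poly_smult poly_mult, simp add: algebra_simps)
    then show "((\<lambda>x. poly Q x * poisson_quad x t powr (-(1/2))) has_vector_derivative
        poly (smult t Q + [:1 + t\<^sup>2, -2 * t:] * pderiv Q) x * poisson_quad x t powr (-(3/2)))
        (at x within {-1..1})"
      by (simp add: has_real_derivative_iff_has_vector_derivative)
  qed simp
  moreover have "poisson_quad 1 t powr (-(1/2)) = 1 / (1 - t)"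
    and "poisson_quad (-1) t powr (-(1/2)) = 1 / (1 + t)"
  proof -
    have "poisson_quad 1 t = (1 - t)\<^sup>2" "poisson_quad (-1) t = (1 + t)\<^sup>2"
      by (simp_all add: poisson_quad_def power2_eq_square algebra_simps)
    moreover have "(y\<^sup>2) powr (-(1/2)) = 1 / y" if "y > 0" for y :: real
      using that by (simp add: powr_minus powr_half_sqrt field_simps)
    ultimately show "poisson_quad 1 t powr (-(1/2)) = 1 / (1 - t)"
      and "poisson_quad (-1) t powr (-(1/2)) = 1 / (1 + t)"
      using t by auto
  qed
  ultimately show ?thesis
    unfolding kernel_integral_def by (simp add: integral_unique)
qed

text \<open>
  Let \<open>G\<close> be the generating function in a variable \<open>s\<close> and \<open>H\<close> its inverse, the formal root. For
  \<open>w = poisson_quad x t\<close>,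
  \<open>d/dx (H / sqrt w) = (t - s) (1 - s t) * G * w powr (-3/2)\<close>.
  Integration over \<open>[-1,1]\<close> turns the left-hand side into
  \<open>(1 - s)/(1 - t) - (1 + s)/(1 + t) = 2 (t - s)/(1 - t\<^sup>2)\<close>. Cancelling \<open>t - s\<close> leaves a geometric series in \<open>s\<close> for the integral of \<open>G\<close>. The argument
  is formal in \<open>s\<close>, one coefficient at a time, so convergence in \<open>s\<close> does not enter.
\<close>

lemma kernel_integral_legendre:
  assumes t: "t \<in> {-1<..<1}"
  shows "kernel_integral (3/2) (legendre k) t = 2 / (1 - t\<^sup>2) * t ^ k"
proof -
  let ?J = "fps_coeffwise (\<lambda>Q. kernel_integral (3/2) Q t)"
  have J_const: "?J (fps_const [:a:] * F) = fps_const a * ?J F" for a F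
    by (rule fps_ext) (simp add: kernel_integral_smult)
  have J_X: "?J (fps_X * F) = fps_X * ?J F" for F
    by (rule fps_ext) simp
  have J_add: "?J (F + K) = ?J F + ?J K" for F K
    by (rule fps_ext) (simp add: kernel_integral_add[OF t])
  have J_diff: "?J (F - K) = ?J F - ?J K" for F K
    by (rule fps_ext) (simp add: kernel_integral_diff[OF t])
  have c1: "fps_const [:0, 2 * t:] = fps_const [:t:] * fps_const [:0, 2:]" 
    by simp
  have c2: "fps_const [:1 + t\<^sup>2, -2 * t:] = fps_const [:1 + t\<^sup>2:] - fps_const [:t:] * fps_const [:0, 2:]"
    by simp
  have "fps_const [:t:] * legendre_root
          + fps_const [:1 + t\<^sup>2, -2 * t:] * fps_coeffwise pderiv legendre_root
      = fps_const [:t:] * legendre_genfun - fps_const [:1 + t\<^sup>2:] * (fps_X * legendre_genfun)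
        + fps_const [:t:] * (fps_X * (fps_X * legendre_genfun))"
    unfolding legendre_root_pderiv unfolding c2 legendre_root_def legendre_quad_def
    by (simp only: ring_distribs power2_eq_square mult_ac mult_1_left mult_minus_right left_diff_distrib
       right_diff_distrib) (simp add: algebra_simps)
  then have "?J (fps_const [:t:] * legendre_root
          + fps_const [:1 + t\<^sup>2, -2 * t:] * fps_coeffwise pderiv legendre_root)
      = (fps_const t - fps_const (1 + t\<^sup>2) * fps_X + fps_const t * (fps_X * fps_X)) * ?J legendre_genfun"
    by (simp only: J_add J_diff J_const J_X) (simp only: ring_distribs mult_ac)
  also have "fps_const t - fps_const (1 + t\<^sup>2) * fps_X + fps_const t * (fps_X * fps_X)
      = (fps_const t - fps_X) * (1 - fps_const t * fps_X)"
  proof -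
    have "fps_const (1 + t\<^sup>2) = 1 + fps_const t * fps_const t" 
      by (simp add: power2_eq_square flip: fps_const_1_eq_1)
    then show ?thesis by (simp add: algebra_simps del: fps_const_mult)
  qed
  also have "?J (fps_const [:t:] * legendre_root
          + fps_const [:1 + t\<^sup>2, -2 * t:] * fps_coeffwise pderiv legendre_root)
      = fps_const (1 / (1 - t)) * fps_coeffwise (\<lambda>p. poly p 1) legendre_root
        - fps_const (1 / (1 + t)) * fps_coeffwise (\<lambda>p. poly p (-1)) legendre_root"
    using kernel_integral_exact[OF t]
    by (intro fps_ext) simp
  also have "\<dots> = (fps_const t - fps_X) * fps_const (2 / (1 - t\<^sup>2))"
  proof -
    have "1 - t\<^sup>2 = (1 - t) * (1 + t)" by (simp add: power2_eq_square algebra_simps)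
    moreover have "1 - t \<noteq> 0" "1 + t \<noteq> 0" using t by auto
    ultimately have "1 / (1 - t) - 1 / (1 + t) = t * (2 / (1 - t\<^sup>2))" 
      "1 / (1 - t) + 1 / (1 + t) = 2 / (1 - t\<^sup>2)"
      by (simp_all add: divide_simps)
    then show ?thesis
      by (intro fps_ext) (auto simp: legendre_root_at_endpoint fps_X_nth)
  qed
  finally have "(fps_const t - fps_X) * ((1 - fps_const t * fps_X) * ?J legendre_genfun)
      = (fps_const t - fps_X) * fps_const (2 / (1 - t\<^sup>2))"
    by (simp add: mult.assoc)
  moreover have "fps_const t - fps_X \<noteq> 0"
    by (metis diff_eq_diff_eq fps_X_neq_fps_const cancel_comm_monoid_add_class.diff_cancel eq_iff_diff_eq_0)
  ultimately have "(1 - fps_const t * fps_X) * ?J legendre_genfun = fps_const (2 / (1 - t\<^sup>2))"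
    by simp
  from fps_geometric_unique[OF this, of k] show ?thesis
    by (simp add: legendre_def)
qed

lemma kernel_integral_legendre_transform:
  assumes t: "t \<in> {-1<..<1}"
  shows "kernel_integral (3/2) (legendre_transform f) t = 2 / (1 - t\<^sup>2) * poly f t"
  unfolding legendre_transform_def
  by (simp add: kernel_integral_sum[OF t] kernel_integral_smult kernel_integral_legendre[OF t] poly_altdef
      sum_distrib_left sum_divide_distrib mult_ac)

section \<open>Zeros of kernel integrals and sign changes\<close>

lemma rolle_finite:
  fixes h h' :: "real \<Rightarrow> real"
  assumes deriv: "\<And>t. t \<in> {a<..<b} \<Longrightarrow> (h has_real_derivative h' t) (at t)"
    and "finite S" "S \<subseteq> {a<..<b}" "\<And>t. t \<in> S \<Longrightarrow> h t = 0"
  obtains S' where "finite S'" "S' \<subseteq> {a<..<b}" "\<And>t. t \<in> S' \<Longrightarrow> h' t = 0"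
    "card S \<le> Suc (card S')"
proof -
  \<comment> \<open>The last conjunct keeps the new zero, found to the right of the old maximum, distinct from the
    earlier ones.\<close>
  have "\<exists>S'. finite S' \<and> S' \<subseteq> {a<..<b} \<and> (\<forall>t\<in>S'. h' t = 0) \<and> card S \<le> Suc (card S')
      \<and> (\<forall>t\<in>S'. \<exists>m\<in>S. t < m)"
    using assms(2-4)
  proof (induction S rule: finite_linorder_max_induct)
    case empty
    show ?case by (intro exI[of _ "{}"]) simp
  next
    case (insert c A)
    then obtain S' where S': "finite S'" "S' \<subseteq> {a<..<b}" "\<forall>t\<in>S'. h' t = 0"
      "card A \<le> Suc (card S')" "\<forall>t\<in>S'. \<exists>m\<in>A. t < m"
      by auto
    show ?case
    proof (cases "A = {}")
      case True
      then show ?thesis by (intro exI[of _ "{}"]) simp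
    next
      case False
      let ?m = "Max A"
      have m: "?m \<in> A" using False insert.hyps by simp
      then have lt: "?m < c" using insert.hyps by blast
      have sub: "{?m..c} \<subseteq> {a<..<b}" using m insert.prems(1) by auto
      have "\<exists>z. ?m < z \<and> z < c \<and> DERIV h z :> 0"
      proof (rule Rolle[OF lt])
        show "h ?m = h c" using insert.prems(2) m by simp
        show "continuous_on {?m..c} h"
          using deriv sub by (meson DERIV_isCont continuous_at_imp_continuous_on subsetD)
        show "h differentiable at x" if "?m < x" "x < c" for x
        proof -
          have "x \<in> {?m..c}" using that by simp
          then have "x \<in> {a<..<b}" using sub by blast
          from deriv[OF this] show ?thesis by (auto simp: real_differentiable_def)
        qed
      qed
      then obtain z where z: "?m < z" "z < c" "DERIV h z :> 0" by blast
      have "z \<in> {?m..c}" using z by simp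
      then have zab: "z \<in> {a<..<b}" using sub by blast
      have "h' z = 0" using DERIV_unique[OF deriv[OF zab] z(3)] .
      moreover have "z \<notin> S'"
        using S'(5) z(1) insert.hyps(1) by (meson Max_ge leD less_le_trans order.strict_trans)
      moreover have "card (insert c A) = Suc (card A)"
        using insert.hyps by (subst card_insert_disjoint) auto
      ultimately show ?thesis
        using S' zab z(2) by (intro exI[of _ "insert z S'"]) auto
    qed
  qed
  then show ?thesis using that by blast
qed

lemma kernel_integral_pos:
  assumes Q: "Q \<noteq> 0" "\<And>x. x \<in> {-1..1} \<Longrightarrow> poly Q x \<ge> 0" and t: "t \<in> {-1<..<1}"
  shows "kernel_integral p Q t > 0"
proof -
  let ?g = "\<lambda>x. poly Q x * poisson_quad x t powr (-p)"
  have nonneg: "?g x \<ge> 0" if "x \<in> {-1..1}" for x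
    using Q(2)[OF that] by simp
  have "kernel_integral p Q t \<noteq> 0"
  proof
    assume "kernel_integral p Q t = 0"
    then have "(?g has_integral 0) (cbox (-1) 1)"
      using kernel_integrable[OF t, of Q p] unfolding kernel_integral_def
      by (simp add: has_integral_integrable_integral)
    then have "?g x = 0" if "x \<in> {-1..1}" for x
      using has_integral_0_cbox_imp_0[of "-1" 1 ?g x] kernel_continuous[OF t] nonneg that by simp
    then have "{-1..1} \<subseteq> {x. poly Q x = 0}"
      using poisson_quad_pos[OF _ t] by force
    moreover have "infinite {-1..1::real}"
      by simp
    ultimately show False
      using poly_roots_finite[OF Q(1)] finite_subset by blast
  qed
  moreover have "kernel_integral p Q t \<ge> 0"
    unfolding kernel_integral_def using nonneg kernel_integrable[OF t]
    by (intro integral_nonneg) auto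
  ultimately show ?thesis by simp
qed

text \<open>Differentiate \<open>(w r t / w x t) powr p\<close> under the integral sign, for \<open>w = poisson_quad\<close>. All
  depends on the identity \<open>(t - r) * w x t - (t - x) * w r t = (x - r) * (1 - t\<^sup>2)\<close>: its
  right-hand side factors, so the derivative is again a kernel integral, of a polynomial whose sign
  change at \<open>r\<close> has been removed.\<close>

lemma kernel_integral_ratio_deriv:
  assumes r: "r \<in> {-1<..<1}" and t: "t \<in> {-1<..<1}"
  shows "((\<lambda>t. poisson_quad r t powr p * kernel_integral p Q t) has_real_derivative
           2 * p * (1 - t\<^sup>2) * poisson_quad r t powr (p - 1)
             * kernel_integral (p + 1) (Q * [:-r, 1:]) t) (at t)"
proof -
  let ?U = "{-1<..<1::real}"
  let ?w = poisson_quad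
  have r': "r \<in> {-1..1}" using r by simp
  define \<phi> where "\<phi> = (\<lambda>t x. poly Q x * (?w r t powr p * ?w x t powr (-p)))"
  define \<psi> where "\<psi> = (\<lambda>t x. 2 * p * (1 - t\<^sup>2) * ?w r t powr (p - 1)
      * (poly (Q * [:-r, 1:]) x * ?w x t powr (-(p + 1))))"
  have phi_int: "integral (cbox (-1) 1) (\<phi> t) = ?w r t powr p * kernel_integral p Q t" for t
    unfolding \<phi>_def kernel_integral_def mult.left_commute[of "poly Q _"] by simp
  have psi_int: "integral (cbox (-1) 1) (\<psi> t) = 2 * p * (1 - t\<^sup>2) * ?w r t powr (p - 1)
      * kernel_integral (p + 1) (Q * [:-r, 1:]) t" for t
    unfolding \<psi>_def kernel_integral_def by simp
  have "((\<lambda>t. integral (cbox (-1) 1) (\<phi> t)) has_real_derivative integral (cbox (-1) 1) (\<psi> t))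
      (at t within ?U)"
  proof (rule leibniz_rule_field_derivative[where U = ?U])
    fix t x assume t: "t \<in> ?U" and x: "x \<in> cbox (-1) (1::real)"
    then have x': "x \<in> {-1..1}" by simp
    have pos: "?w r t > 0" "?w x t > 0"
      using poisson_quad_pos[OF r' t] poisson_quad_pos[OF x' t] .
    have quad: "((\<lambda>t. ?w y t) has_real_derivative 2 * (t - y)) (at t)" for y
      unfolding poisson_quad_def by (auto intro!: derivative_eq_intros)
    have powr: "((\<lambda>t. ?w y t powr q) has_real_derivative q * ?w y t powr (q - 1) * (2 * (t - y))) (at t)"
      if "?w y t > 0" for y q
      using has_real_derivative_powr[OF that] quad by (rule DERIV_chain2)
    have step: "?w r t powr p = ?w r t powr (p - 1) * ?w r t"
      "?w x t powr (-p) = ?w x t powr (-(p + 1)) * ?w x t"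
      using pos powr_add[of "?w r t" "p - 1" 1] powr_add[of "?w x t" "-(p + 1)" 1] by simp_all
    have exp: "- p - 1 = - (p + 1)" by simp
    have key: "(t - r) * ?w x t - (t - x) * ?w r t = (x - r) * (1 - t\<^sup>2)"
      by (simp add: poisson_quad_def power2_eq_square algebra_simps)
    have alg: "q * (p * a * (2 * u) * (b * W) + (-p) * b * (2 * v) * (a * V))
        = 2 * p * q * a * b * (u * W - v * V)" for q a b u v W V :: real
      by (simp add: algebra_simps)
    have "poly Q x * (p * ?w r t powr (p - 1) * (2 * (t - r)) * ?w x t powr (-p)
        + (-p) * ?w x t powr (-p - 1) * (2 * (t - x)) * ?w r t powr p)
      = 2 * p * poly Q x * ?w r t powr (p - 1) * ?w x t powr (-(p + 1))
         * ((t - r) * ?w x t - (t - x) * ?w r t)"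
      unfolding step exp by (rule alg)
    also have "\<dots> = \<psi> t x"
      unfolding key \<psi>_def by (simp add: algebra_simps)
    finally have "poly Q x * (p * ?w r t powr (p - 1) * (2 * (t - r)) * ?w x t powr (-p)
        + (-p) * ?w x t powr (-p - 1) * (2 * (t - x)) * ?w r t powr p) = \<psi> t x" .
    then have "((\<lambda>t. \<phi> t x) has_real_derivative \<psi> t x) (at t)"
      unfolding \<phi>_def
      by (rule DERIV_cong[OF DERIV_cmult[OF DERIV_mult[OF powr[OF pos(1)] powr[OF pos(2)]]]])
    then show "((\<lambda>t. \<phi> t x) has_real_derivative \<psi> t x) (at t within ?U)"
      by (rule has_field_derivative_at_within)
  next
    fix t assume t: "t \<in> ?U"
    have "(\<lambda>x. ?w r t powr p * (poly Q x * ?w x t powr (-p))) integrable_on {-1..1}"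
      by (rule integrable_on_mult_right[OF kernel_integrable[OF t]])
    then show "\<phi> t integrable_on cbox (-1) 1"
      by (simp add: \<phi>_def mult_ac)
  next
    have "?w (snd z) (fst z) \<noteq> 0" "?w r (fst z) \<noteq> 0" if "z \<in> ?U \<times> {-1..1}" for z
      using poisson_quad_pos[of "snd z" "fst z"] poisson_quad_pos[OF r', of "fst z"] that by auto
    moreover have "continuous_on (?U \<times> {-1..1}) (\<lambda>z. ?w (snd z) (fst z))"
      "continuous_on (?U \<times> {-1..1}) (\<lambda>z. ?w r (fst z))"
      unfolding poisson_quad_def by (intro continuous_intros)+
    ultimately show "continuous_on (?U \<times> cbox (-1) 1) (\<lambda>(t, x). \<psi> t x)"
      unfolding \<psi>_def split_beta cbox_interval by (intro continuous_intros) auto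
  next
    show "t \<in> ?U" by (rule t)
    show "convex ?U" by simp
  qed
  then show ?thesis
    unfolding phi_int psi_int using at_within_open[OF t] by simp
qed

text \<open>Induction on the sign changes \<open>R\<close>, by Rolle's theorem. The transform of \<open>Q\<close> has the same
  zeros after multiplication by the positive function \<open>poisson_quad r t powr p\<close>.\<close>

lemma kernel_zeros_le_sign_changes:
  assumes "finite R" "R \<subseteq> {-1<..<1}" "Q \<noteq> 0" "p > 0"
    and "\<And>x. x \<in> {-1..1} \<Longrightarrow> poly (Q * (\<Prod>r\<in>R. [:-r, 1:])) x \<ge> 0"
    and "finite S" "S \<subseteq> {-1<..<1}" "\<And>t. t \<in> S \<Longrightarrow> kernel_integral p Q t = 0"
  shows "card S \<le> card R"
  using assms
proof (induction R arbitrary: p Q S rule: finite_induct)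
  case empty
  have "kernel_integral p Q t > 0" if "t \<in> S" for t
    using empty that by (intro kernel_integral_pos) auto
  then have "S = {}" using empty.prems(7) by force
  then show ?case by simp
next
  case (insert r R)
  have r: "r \<in> {-1<..<1}" using insert.prems by simp
  let ?Q' = "Q * [:-r, 1:]"
  obtain S' where S': "finite S'" "S' \<subseteq> {-1<..<1}" "card S \<le> Suc (card S')"
    "\<And>t. t \<in> S' \<Longrightarrow> 2 * p * (1 - t\<^sup>2) * poisson_quad r t powr (p - 1)
             * kernel_integral (p + 1) ?Q' t = 0"
    by (rule rolle_finite[OF kernel_integral_ratio_deriv[OF r, of _ p Q] insert.prems(5,6)])
       (use insert.prems(7) in auto)
  have "kernel_integral (p + 1) ?Q' t = 0" if "t \<in> S'" for t
  proof -
    have t: "t \<in> {-1<..<1}" using S'(2) that by blast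
    then have "t\<^sup>2 < 1" by (auto simp: abs_square_less_1)
    moreover have "poisson_quad r t > 0" using poisson_quad_pos[of r t] r t by simp
    ultimately show ?thesis using S'(4)[OF that] insert.prems(3) by auto
  qed
  moreover have "?Q' \<noteq> 0"
    using insert.prems(2) by (metis mult_eq_0_iff pCons_eq_0_iff zero_neq_one)
  moreover have "poly (?Q' * (\<Prod>r\<in>R. [:-r, 1:])) x \<ge> 0" if "x \<in> {-1..1}" for x
    using insert.prems(4)[OF that] unfolding prod.insert[OF insert.hyps] mult.assoc .
  ultimately have "card S' \<le> card R"
    using insert.prems(1,3) S' by (intro insert.IH[of ?Q' "p + 1"]) auto
  then show ?case using S'(3) insert.hyps by simp
qed

text \<open>The set \<open>R\<close> consists of the zeros of odd order. Splitting off one linear factor at a time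
  toggles membership in \<open>R\<close>, which avoids speaking of orders.\<close>

lemma sign_change_points:
  fixes Q :: "real poly"
  assumes "Q \<noteq> 0"
  obtains R where "R \<subseteq> {x \<in> {-1<..<1}. poly Q x = 0}"
    "(\<forall>x\<in>{-1..1}. poly (Q * (\<Prod>r\<in>R. [:-r, 1:])) x \<ge> 0) \<or>
     (\<forall>x\<in>{-1..1}. poly (Q * (\<Prod>r\<in>R. [:-r, 1:])) x \<le> 0)"
proof -
  have "\<exists>R \<subseteq> {x \<in> {-1<..<1}. poly Q x = 0}.
    (\<forall>x\<in>{-1..1}. poly (Q * (\<Prod>r\<in>R. [:-r, 1:])) x \<ge> 0) \<or>
     (\<forall>x\<in>{-1..1}. poly (Q * (\<Prod>r\<in>R. [:-r, 1:])) x \<le> 0)"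
    using assms
  proof (induction "degree Q" arbitrary: Q rule: less_induct)
    case less
    show ?case
    proof (cases "\<exists>r\<in>{-1<..<1}. poly Q r = 0")
      case False
      have "(\<forall>x\<in>{-1..1}. poly Q x \<ge> 0) \<or> (\<forall>x\<in>{-1..1}. poly Q x \<le> 0)"
      proof (rule ccontr)
        assume "\<not> ?thesis"
        then obtain x y where xy: "x \<in> {-1..1}" "y \<in> {-1..1}" "poly Q x < 0" "poly Q y > 0"
          by force
        then have "x \<noteq> y" by auto
        then consider "x < y" | "y < x" by linarith
        then obtain z where "z \<in> {-1<..<1}" "poly Q z = 0"
        proof cases
          case 1
          with poly_IVT_pos[of x y Q] xy that show thesis by force
        next
          case 2
          with poly_IVT_neg[of y x Q] xy that show thesis by force
        qed
        with False show False by blast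
      qed
      then show ?thesis by (intro exI[of _ "{}"]) simp
    next
      case True
      then obtain r where r: "r \<in> {-1<..<1}" "poly Q r = 0" by blast
      then obtain P where P: "Q = [:-r, 1:] * P"
        using poly_eq_0_iff_dvd by (metis dvdE)
      have "P \<noteq> 0" using P less.prems by auto
      then have "degree P < degree Q"
        unfolding P by (subst degree_mult_eq) auto
      then obtain R where R: "R \<subseteq> {x \<in> {-1<..<1}. poly P x = 0}"
        "(\<forall>x\<in>{-1..1}. poly (P * (\<Prod>r\<in>R. [:-r, 1:])) x \<ge> 0) \<or>
         (\<forall>x\<in>{-1..1}. poly (P * (\<Prod>r\<in>R. [:-r, 1:])) x \<le> 0)"
        using less.hyps \<open>P \<noteq> 0\<close> by blast
      have fin: "finite R"
        by (rule finite_subset[OF _ poly_roots_finite[OF \<open>P \<noteq> 0\<close>]]) (use R(1) in blast)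
      show ?thesis
      proof (cases "r \<in> R")
        case True
        have "Q * (\<Prod>r\<in>R - {r}. [:-r, 1:]) = P * (\<Prod>r\<in>R. [:-r, 1:])"
          unfolding P prod.remove[OF fin True] by (simp only: mult_ac)
        then show ?thesis
          using R P by (intro exI[of _ "R - {r}"]) auto
      next
        case False
        have "Q * (\<Prod>r\<in>insert r R. [:-r, 1:])
            = [:-r, 1:] * [:-r, 1:] * (P * (\<Prod>r\<in>R. [:-r, 1:]))"
          unfolding P prod.insert[OF fin False] by (simp only: mult_ac)
        then have "poly (Q * (\<Prod>r\<in>insert r R. [:-r, 1:])) x
            = (x - r)\<^sup>2 * poly (P * (\<Prod>r\<in>R. [:-r, 1:])) x" for x
          by (simp add: power2_eq_square algebra_simps)
        then show ?thesis
          using R P r(1)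
          by (intro exI[of _ "insert r R"])
            (auto simp: zero_le_mult_iff mult_le_0_iff simp del: poly_mult)
      qed
    qed
  qed
  then show ?thesis using that by blast
qed

section \<open>Polynomials with distinct zeros\<close>

lemma legendre_transform_altdef:
  assumes "degree f \<le> n"
  shows "legendre_transform f = (\<Sum>k\<le>n. smult (coeff f k) (legendre k))"
  unfolding legendre_transform_def
  by (rule sum.mono_neutral_left) (use assms in \<open>auto simp: coeff_eq_0\<close>)

lemma degree_legendre_transform_le: "degree (legendre_transform f) \<le> degree f"
  unfolding legendre_transform_def
  by (rule degree_sum_le)
    (auto intro: order.trans[OF degree_smult_le] order.trans[OF degree_legendre_le])

lemma coeff_legendre_transform_degree:
  "coeff (legendre_transform f) (degree f) = lead_coeff f * coeff (legendre (degree f)) (degree f)"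
proof -
  have "coeff (legendre k) (degree f) = 0" if "k < degree f" for k
    using that degree_legendre_le[of k] by (intro coeff_eq_0) simp
  then show ?thesis
    unfolding legendre_transform_def coeff_sum
    by (subst sum.remove[of _ "degree f"]) (auto intro!: sum.neutral)
qed

lemma legendre_transform_smult:
  "legendre_transform (smult c f) = smult c (legendre_transform f)"
  unfolding legendre_transform_altdef[OF degree_smult_le] legendre_transform_def
  by (rule poly_eqI) (simp add: coeff_sum sum_distrib_left mult.assoc)

lemma poly_legendre_transform_at_endpoint:
  assumes "e ^ 2 = (1 :: real)"
  shows "poly (legendre_transform f) e = poly f e"
  unfolding legendre_transform_def
  by (simp add: poly_sum poly_legendre_at_endpoint[OF assms] poly_altdef[of f])

lemma poly_eq_prod_roots:
  fixes Q :: "real poly"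
  assumes "Q \<noteq> 0" "finite R" "\<And>r. r \<in> R \<Longrightarrow> poly Q r = 0" "degree Q \<le> card R"
  shows "degree Q = card R" "Q = smult (lead_coeff Q) (\<Prod>r\<in>R. [:-r, 1:])"
proof -
  let ?P = "\<Prod>r\<in>R. [:-r, 1:]"
  have "?P dvd Q"
    using assms(2,3)
  proof (induction R rule: finite_induct)
    case (insert r R)
    then obtain K where K: "Q = (\<Prod>r\<in>R. [:-r, 1:]) * K" by (auto elim: dvdE)
    have "poly (\<Prod>r\<in>R. [:-r, 1:]) r \<noteq> 0"
      using insert.hyps by (auto simp: poly_prod)
    then have "[:-r, 1:] dvd K"
      using insert.prems[of r] K by (simp add: poly_eq_0_iff_dvd[symmetric])
    then show ?case
      unfolding prod.insert[OF insert.hyps] K mult.commute[of "[:-r, 1:]"] by (rule mult_dvd_mono[OF dvd_refl])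
  qed simp
  then obtain K where K: "Q = ?P * K" by (elim dvdE)
  have P: "degree ?P = card R" "lead_coeff ?P = 1"
    unfolding lead_coeff_prod by (simp_all add: degree_prod_eq_sum_degree)
  have "K \<noteq> 0" "?P \<noteq> 0" using K assms(1) by auto
  then have deg: "degree Q = card R + degree K"
    using P(1) unfolding K by (simp add: degree_mult_eq)
  with assms(4) show "degree Q = card R" by simp
  have "degree K = 0" using deg assms(4) by simp
  then obtain c where "K = [:c:]" by (elim degree_eq_zeroE)
  then show "Q = smult (lead_coeff Q) ?P"
    using K P(2) by (simp add: lead_coeff_mult)
qed

text \<open>The \<open>n = card S\<close> zeros of \<open>f\<close> force \<open>n\<close> sign changes on its transform, whose degree is at
  most \<open>n\<close>. The leading coefficient of the transform is that of \<open>P\<^sub>n\<close>, whatever the zeros are,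
  which makes the limit below possible.\<close>

lemma legendre_transform_distinct:
  assumes S: "finite S" "S \<subseteq> {-1<..<1}"
  defines "f \<equiv> \<Prod>s\<in>S. [:-s, 1:]"
  obtains R where "R \<subseteq> {-1<..<1}" "card R = card S" "coeff (legendre (card S)) (card S) \<noteq> 0"
    "legendre_transform f = smult (coeff (legendre (card S)) (card S)) (\<Prod>r\<in>R. [:-r, 1:])"
proof -
  let ?Q = "legendre_transform f"
  have deg: "degree f = card S" and "f \<noteq> 0"
    unfolding f_def using S(1) by (simp_all add: degree_prod_eq_sum_degree)
  have lead: "lead_coeff f = 1"
    unfolding f_def lead_coeff_prod by simp
  have Qf: "kernel_integral (3/2) ?Q t = 2 / (1 - t\<^sup>2) * poly f t" if "t \<in> {-1<..<1}" for t
    by (rule kernel_integral_legendre_transform[OF that])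
  have "?Q \<noteq> 0"
  proof
    assume "?Q = 0"
    have "poly f t = 0" if t: "t \<in> {-1<..<1}" for t
    proof -
      have "t\<^sup>2 < 1" using t by (auto simp: abs_square_less_1)
      then show ?thesis using Qf[OF t] \<open>?Q = 0\<close> by simp
    qed
    then have "{-1<..<1} \<subseteq> {t. poly f t = 0}" by blast
    moreover have "infinite {-1<..<1::real}" by simp
    ultimately show False
      using poly_roots_finite[OF \<open>f \<noteq> 0\<close>] finite_subset by blast
  qed
  then obtain R where R: "R \<subseteq> {x \<in> {-1<..<1}. poly ?Q x = 0}"
    "(\<forall>x\<in>{-1..1}. poly (?Q * (\<Prod>r\<in>R. [:-r, 1:])) x \<ge> 0) \<or>
     (\<forall>x\<in>{-1..1}. poly (?Q * (\<Prod>r\<in>R. [:-r, 1:])) x \<le> 0)"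
    by (rule sign_change_points)
  have finR: "finite R"
    by (rule finite_subset[OF _ poly_roots_finite[OF \<open>?Q \<noteq> 0\<close>]]) (use R(1) in blast)
  define \<sigma> :: real where
    "\<sigma> = (if \<forall>x\<in>{-1..1}. poly (?Q * (\<Prod>r\<in>R. [:-r, 1:])) x \<ge> 0 then 1 else -1)"
  have "card S \<le> card R"
  proof (rule kernel_zeros_le_sign_changes[where Q = "smult \<sigma> ?Q" and p = "3/2"])
    show "poly (smult \<sigma> ?Q * (\<Prod>r\<in>R. [:-r, 1:])) x \<ge> 0" if "x \<in> {-1..1}" for x
      using R(2) that by (auto simp: \<sigma>_def)
    show "kernel_integral (3/2) (smult \<sigma> ?Q) t = 0" if "t \<in> S" for t
    proof -
      have "poly f t = 0" using that S(1) by (auto simp: f_def poly_prod)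
      moreover have "t \<in> {-1<..<1}" using that S(2) by blast
      ultimately show ?thesis by (simp add: kernel_integral_smult Qf)
    qed
  qed (use S R(1) finR \<open>?Q \<noteq> 0\<close> in \<open>auto simp: \<sigma>_def\<close>)
  then have le: "degree ?Q \<le> card R"
    using degree_legendre_transform_le[of f] deg by simp
  have roots: "degree ?Q = card R" "?Q = smult (lead_coeff ?Q) (\<Prod>r\<in>R. [:-r, 1:])"
    using poly_eq_prod_roots[OF \<open>?Q \<noteq> 0\<close> finR _ le] R(1) by blast+
  then have "card R = card S"
    using \<open>card S \<le> card R\<close> degree_legendre_transform_le[of f] deg by simp
  moreover from this have "lead_coeff ?Q = coeff (legendre (card S)) (card S)"
    using coeff_legendre_transform_degree[of f] roots(1) deg lead by simp
  moreover have "lead_coeff ?Q \<noteq> 0" using \<open>?Q \<noteq> 0\<close> by simp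
  ultimately show thesis
    using that[of R] R(1) roots(2) by (metis (no_types, lifting) mem_Collect_eq subset_eq)
qed

section \<open>Multiple zeros by a limit\<close>

definition cpoly :: "real poly \<Rightarrow> complex \<Rightarrow> complex" where
  "cpoly p z = poly (map_poly of_real p) z"

lemma cpoly_pCons [simp]: "cpoly (pCons a p) z = of_real a + z * cpoly p z"
  by (simp add: cpoly_def map_poly_pCons)

lemma cpoly_0 [simp]: "cpoly 0 z = 0"
  by (simp add: cpoly_def)

lemma cpoly_1 [simp]: "cpoly 1 z = 1"
  by (simp add: cpoly_def)

lemma cpoly_add [simp]: "cpoly (p + q) z = cpoly p z + cpoly q z"
proof -
  have "map_poly complex_of_real (p + q) = map_poly of_real p + map_poly of_real q"
    by (rule poly_eqI) (simp add: coeff_map_poly)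
  then show ?thesis by (simp add: cpoly_def)
qed

lemma cpoly_smult [simp]: "cpoly (smult c p) z = of_real c * cpoly p z"
  by (induction p) (simp_all add: algebra_simps)

lemma cpoly_mult [simp]: "cpoly (p * q) z = cpoly p z * cpoly q z"
  by (induction p) (simp_all add: algebra_simps)

lemma cpoly_sum: "cpoly (\<Sum>i\<in>A. p i) z = (\<Sum>i\<in>A. cpoly (p i) z)"
  by (induction A rule: infinite_finite_induct) simp_all

lemma cpoly_prod: "cpoly (\<Prod>i\<in>A. p i) z = (\<Prod>i\<in>A. cpoly (p i) z)"
  by (induction A rule: infinite_finite_induct) simp_all

lemma cpoly_of_real: "cpoly p (of_real x) = of_real (poly p x)"
  by (induction p) simp_all

text \<open>A bound on the transform away from the interval that depends on the zeros only through their
  number, and hence passes to the limit when zeros merge.\<close>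

lemma norm_legendre_transform_distinct:
  assumes S: "finite S" "S \<subseteq> {-1<..<1}"
    and d: "d \<ge> 0" "\<And>x. x \<in> {-1<..<1} \<Longrightarrow> d \<le> norm (z - complex_of_real x)"
  shows "\<bar>coeff (legendre (card S)) (card S)\<bar> * d ^ card S
           \<le> norm (cpoly (legendre_transform (\<Prod>s\<in>S. [:-s, 1:])) z)"
    and "coeff (legendre (card S)) (card S) \<noteq> 0"
proof -
  obtain R where R: "R \<subseteq> {-1<..<1}" "card R = card S" "coeff (legendre (card S)) (card S) \<noteq> 0"
    "legendre_transform (\<Prod>s\<in>S. [:-s, 1:])
       = smult (coeff (legendre (card S)) (card S)) (\<Prod>r\<in>R. [:-r, 1:])"
    using legendre_transform_distinct[OF S] by blast
  show "coeff (legendre (card S)) (card S) \<noteq> 0" by (rule R(3))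
  have "d ^ card S = (\<Prod>r\<in>R. d)" by (simp add: R(2))
  also have "\<dots> \<le> (\<Prod>r\<in>R. norm (z - complex_of_real r))"
    using d R(1) by (intro prod_mono) auto
  finally have "\<bar>coeff (legendre (card S)) (card S)\<bar> * d ^ card S \<le>
      \<bar>coeff (legendre (card S)) (card S)\<bar> * (\<Prod>r\<in>R. norm (z - complex_of_real r))"
    by (rule mult_left_mono) simp
  then show "\<bar>coeff (legendre (card S)) (card S)\<bar> * d ^ card S
      \<le> norm (cpoly (legendre_transform (\<Prod>s\<in>S. [:-s, 1:])) z)"
    unfolding R(4) by (simp add: cpoly_prod norm_mult prod_norm)
qed

lemma tendsto_coeff_prod_linear:
  fixes a :: "'a \<Rightarrow> 'b \<Rightarrow> real"
  assumes "\<And>i. i \<in> A \<Longrightarrow> ((\<lambda>e. a e i) \<longlongrightarrow> b i) F"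
  shows "((\<lambda>e. coeff (\<Prod>i\<in>A. [:-a e i, 1:]) k) \<longlongrightarrow> coeff (\<Prod>i\<in>A. [:-b i, 1:]) k) F"
  using assms
proof (induction A arbitrary: k rule: infinite_finite_induct)
  case (insert j A)
  have "((\<lambda>e. - a e j * coeff (\<Prod>i\<in>A. [:-a e i, 1:]) k
        + (case k of 0 \<Rightarrow> 0 | Suc l \<Rightarrow> coeff (\<Prod>i\<in>A. [:-a e i, 1:]) l))
      \<longlongrightarrow> - b j * coeff (\<Prod>i\<in>A. [:-b i, 1:]) k
        + (case k of 0 \<Rightarrow> 0 | Suc l \<Rightarrow> coeff (\<Prod>i\<in>A. [:-b i, 1:]) l)) F"
    using insert by (cases k) (auto intro!: tendsto_intros)
  then show ?case
    using insert.hyps by (simp add: coeff_pCons)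
qed simp_all

text \<open>Listing the zeros in increasing order makes \<open>r i + \<epsilon> * i\<close> pairwise distinct for every
  \<open>\<epsilon> > 0\<close>.\<close>

lemma legendre_transform_root_closed:
  fixes n :: nat
  assumes r: "\<And>i. i < n \<Longrightarrow> r i \<in> {-1<..<1::real}" and mono: "mono_on {..<n} r"
    and root: "cpoly (legendre_transform (\<Prod>i<n. [:-r i, 1:])) z = 0"
  shows "z \<in> complex_of_real ` {-1..1}"
proof (rule ccontr)
  assume "z \<notin> complex_of_real ` {-1..1}"
  moreover have "closed (complex_of_real ` {-1..1})"
    by (rule compact_imp_closed[OF compact_continuous_image[OF _ compact_Icc]])
      (rule continuous_on_of_real[OF continuous_on_id])
  ultimately obtain d where d: "d > 0" "\<forall>y \<in> complex_of_real ` {-1..1}. d \<le> dist z y"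
    using separate_point_closed[of "complex_of_real ` {-1..1}" z] by blast
  let ?c = "coeff (legendre n) n"
  define f where "f = (\<lambda>\<epsilon>. \<Prod>i<n. [:-(r i + \<epsilon> * real i), 1:])"
  have deg: "degree (f \<epsilon>) \<le> n" for \<epsilon>
    by (simp add: f_def degree_prod_eq_sum_degree)
  have small: "\<forall>\<^sub>F \<epsilon> in at_right 0. \<forall>i\<in>{..<n}. r i + \<epsilon> * real i < 1"
  proof (rule eventually_ball_finite)
    show "\<forall>i\<in>{..<n}. \<forall>\<^sub>F \<epsilon> in at_right 0. r i + \<epsilon> * real i < 1"
    proof
      fix i assume "i \<in> {..<n}"
      then have "r i + 0 * real i < 1" using r[of i] by simp
      moreover have "((\<lambda>\<epsilon>. r i + \<epsilon> * real i) \<longlongrightarrow> r i + 0 * real i) (at_right 0)"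
        by (intro tendsto_intros)
      ultimately show "\<forall>\<^sub>F \<epsilon> in at_right 0. r i + \<epsilon> * real i < 1"
        by (rule order_tendstoD(2)[rotated])
    qed
  qed simp
  have bound: "\<forall>\<^sub>F \<epsilon> in at_right 0.
      ?c \<noteq> 0 \<and> \<bar>?c\<bar> * d ^ n \<le> norm (cpoly (legendre_transform (f \<epsilon>)) z)"
    using small eventually_at_right_less[of 0]
  proof eventually_elim
    case (elim \<epsilon>)
    let ?s = "\<lambda>i. r i + \<epsilon> * real i"
    have "strict_mono_on {..<n} ?s"
      using mono elim(2) by (auto simp: strict_mono_on_def mono_on_def intro: add_le_less_mono)
    then have inj: "inj_on ?s {..<n}"
      by (rule strict_mono_on_imp_inj_on)
    have "?s i \<in> {-1<..<1}" if "i < n" for i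
    proof -
      have "0 \<le> \<epsilon> * real i" using elim(2) by simp
      then show ?thesis using elim(1) r[OF that] that by auto
    qed
    then have "?s ` {..<n} \<subseteq> {-1<..<1}" by blast
    moreover have "card (?s ` {..<n}) = n"
      using inj by (simp add: card_image)
    moreover have "f \<epsilon> = (\<Prod>s\<in>?s ` {..<n}. [:-s, 1:])"
      unfolding f_def prod.reindex[OF inj] by simp
    ultimately show ?case
      using norm_legendre_transform_distinct[of "?s ` {..<n}" d z] d by (auto simp: dist_norm)
  qed
  have "((\<lambda>\<epsilon>. cpoly (legendre_transform (f \<epsilon>)) z) \<longlongrightarrow> cpoly (legendre_transform (f 0)) z)
      (at_right 0)"
    unfolding legendre_transform_altdef[OF deg] cpoly_sum cpoly_smult unfolding f_def
    by (intro tendsto_intros tendsto_coeff_prod_linear)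
  moreover have "cpoly (legendre_transform (f 0)) z = 0"
    using root by (simp add: f_def)
  ultimately have "((\<lambda>\<epsilon>. norm (cpoly (legendre_transform (f \<epsilon>)) z)) \<longlongrightarrow> 0) (at_right 0)"
    by (metis tendsto_norm_zero)
  then have "\<bar>?c\<bar> * d ^ n \<le> 0"
    by (rule tendsto_lowerbound) (use bound in \<open>auto elim: eventually_mono\<close>)
  moreover have "?c \<noteq> 0"
    using eventually_happens'[OF _ bound] by (simp add: trivial_limit_at_right_real)
  moreover have "d ^ n > 0"
    using d(1) by simp
  ultimately show False
    by (simp add: mult_le_0_iff)
qed

lemma real_rooted_splits:
  fixes f :: "real poly"
  assumes "f \<noteq> 0" "\<And>z. cpoly f z = 0 \<Longrightarrow> z \<in> complex_of_real ` A"
  obtains c M where "c \<noteq> 0" "set_mset M \<subseteq> A" "f = smult c (\<Prod>x\<in>#M. [:-x, 1:])"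
proof -
  have "\<exists>c M. c \<noteq> 0 \<and> set_mset M \<subseteq> A \<and> f = smult c (\<Prod>x\<in>#M. [:-x, 1:])"
    using assms
  proof (induction "degree f" arbitrary: f)
    case 0
    then obtain c where "f = [:c:]" by (metis degree_eq_zeroE)
    with 0 show ?case by (intro exI[of _ c] exI[of _ "{#}"]) auto
  next
    case (Suc n)
    have "degree (map_poly complex_of_real f) = Suc n"
      using Suc.hyps(2) by (simp add: degree_map_poly)
    then have "\<not> constant (poly (map_poly complex_of_real f))"
      by (simp add: constant_degree)
    then obtain z where "cpoly f z = 0"
      unfolding cpoly_def using fundamental_theorem_of_algebra by blast
    with Suc.prems(2) obtain x where x: "x \<in> A" "z = of_real x" by blast
    with \<open>cpoly f z = 0\<close> have "poly f x = 0" by (simp add: cpoly_of_real)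
    then obtain g where g: "f = [:-x, 1:] * g"
      using poly_eq_0_iff_dvd by (metis dvdE)
    have "g \<noteq> 0" using g Suc.prems(1) by auto
    moreover have "n = degree g"
      using Suc.hyps(2) degree_mult_eq[of "[:-x, 1:]" g] \<open>g \<noteq> 0\<close> unfolding g[symmetric] by simp
    moreover have "w \<in> complex_of_real ` A" if "cpoly g w = 0" for w
      using Suc.prems(2)[of w] that unfolding g cpoly_mult by simp
    ultimately obtain c M where "c \<noteq> 0" "set_mset M \<subseteq> A" "g = smult c (\<Prod>x\<in>#M. [:-x, 1:])"
      using Suc.hyps(1) by blast
    then show ?case
      using x(1) g by (intro exI[of _ c] exI[of _ "add_mset x M"]) simp
  qed
  then show ?thesis using that by blast
qed

section \<open>The zeros of the transform\<close>

theorem mainTheorem2: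
  fixes f :: "real poly"
  assumes "\<forall>z :: complex. poly (map_poly complex_of_real f) z = 0 \<longrightarrow>
             z \<in> complex_of_real ` {-1<..<1}"
  shows "\<forall>z :: complex. poly (map_poly complex_of_real (legendre_transform f)) z = 0 \<longrightarrow>
             z \<in> complex_of_real ` {-1<..<1}"
proof (intro allI impI)
  fix z assume "poly (map_poly complex_of_real (legendre_transform f)) z = 0"
  then have root: "cpoly (legendre_transform f) z = 0" by (simp add: cpoly_def)
  have zeros: "w \<in> complex_of_real ` {-1<..<1}" if "cpoly f w = 0" for w
    using assms that by (simp add: cpoly_def)
  have "f \<noteq> 0" using zeros[of 2] by (auto simp: complex_eq_iff)
  then obtain c M where cM: "c \<noteq> 0" "set_mset M \<subseteq> {-1<..<1}"
    "f = smult c (\<Prod>x\<in>#M. [:-x, 1:])"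
    using zeros by (rule real_rooted_splits)
  define xs where "xs = sorted_list_of_multiset M"
  have xs: "sorted xs" "mset xs = M" by (simp_all add: xs_def)
  have "(\<Prod>x\<in>#M. [:-x, 1:]) = (\<Prod>i<length xs. [:-(xs ! i), 1:])"
    unfolding xs(2)[symmetric]
    by (simp add: prod_mset_prod_list prod.list_conv_set_nth atLeast0LessThan flip: mset_map)
  then have f: "f = smult c (\<Prod>i<length xs. [:-(xs ! i), 1:])" using cM(3) by simp
  from root cM(1) have "cpoly (legendre_transform (\<Prod>i<length xs. [:-(xs ! i), 1:])) z = 0"
    unfolding f legendre_transform_smult by simp
  moreover have "xs ! i \<in> {-1<..<1}" if "i < length xs" for i
    using cM(2) xs(2) nth_mem[OF that] by (metis set_mset_mset subsetD)
  moreover have "mono_on {..<length xs} ((!) xs)"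
    using xs(1) by (auto simp: mono_on_def sorted_nth_mono)
  ultimately have "z \<in> complex_of_real ` {-1..1}"
    by (intro legendre_transform_root_closed[of "length xs" "(!) xs"])
  then obtain x where x: "x \<in> {-1..1}" "z = of_real x" by blast
  have "x \<noteq> e" if "e ^ 2 = 1" for e
  proof
    assume "x = e"
    with root x(2) have "poly (legendre_transform f) e = 0" by (simp add: cpoly_of_real)
    then have "cpoly f (of_real e) = 0"
      by (simp add: poly_legendre_transform_at_endpoint[OF that] cpoly_of_real)
    then have "e \<in> {-1<..<1}" using zeros by force
    then have "e ^ 2 < 1" by (auto simp: abs_square_less_1)
    with that show False by simp
  qed
  from this[of 1] this[of "-1"] x show "z \<in> complex_of_real ` {-1<..<1}" by auto
qed

end
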